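(* For every $t\ge 0$ and every complex $z$ with $|z|\le 1$, the probability generating function $P(z,t)=E\big[z^{N(t)}\big]=\sum_{n\ge 0}z^nP(N(t)=n)$ of the number of customers in the system equals $$P(z,t)=\exp\Big(-\nu t-\lambda(1-z)\int_0^t(1-B(x))\,dx\Big)+\nu\int_0^t\exp\Big(-\nu u-\lambda(1-z)\int_0^u(1-B(x))\,dx\Big)\,du .$$
   Context: Model $M|G|\infty$ with catastrophes: customers arrive according to a homogeneous Poisson process with rate $\lambda>0$; catastrophes occur according to an independent homogeneous Poisson process with rate $\nu\ge 0$; service times are i.i.d. with distribution function $B$ on $[0,\infty)$ ($B(x)=P(\beta\le x)$), with finite mean $b_1$, and are independent of the arrival and catastrophe processes. There are infinitely many servers, so every arriving customer starts service immediately and departs when its service ends, unless a catastrophe occurs earlier: at each catastrophe epoch all customers present are removed instantaneously (a catastrophe occurring when the system is empty has no effect). The system is empty at time $0$. $N(t)$ is the number of customers present at time $t\ge 0$. *)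

theory Defs
  imports "HOL-Probability.Probability"
begin

text \<open>Sources of randomness of the M/G/infinity queue with catastrophes:
  interarrival times (Arr i), service times (Serv i), inter-catastrophe times (Cat i).\<close>
datatype mgi_src = Arr nat | Serv nat | Cat nat

definition arrival_time :: "(nat \<Rightarrow> 'a \<Rightarrow> real) \<Rightarrow> nat \<Rightarrow> 'a \<Rightarrow> real" where
  "arrival_time A k \<omega> = (\<Sum>i\<le>k. A i \<omega>)"

definition catastrophes :: "real \<Rightarrow> (nat \<Rightarrow> 'a \<Rightarrow> real) \<Rightarrow> 'a \<Rightarrow> real set" where
  "catastrophes nu D \<omega> = (if nu = 0 then {} else range (\<lambda>j. \<Sum>i\<le>j. D i \<omega>))"

definition in_system ::
  "(nat \<Rightarrow> 'a \<Rightarrow> real) \<Rightarrow> (nat \<Rightarrow> 'a \<Rightarrow> real) \<Rightarrow> real \<Rightarrow> (nat \<Rightarrow> 'a \<Rightarrow> real)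
     \<Rightarrow> real \<Rightarrow> 'a \<Rightarrow> nat \<Rightarrow> bool" where
  "in_system A beta nu D t \<omega> k \<longleftrightarrow>
     arrival_time A k \<omega> \<le> t \<and> t < arrival_time A k \<omega> + beta k \<omega> \<and>
     (\<forall>c\<in>catastrophes nu D \<omega>. \<not> (arrival_time A k \<omega> \<le> c \<and> c \<le> t))"

definition num_customers ::
  "(nat \<Rightarrow> 'a \<Rightarrow> real) \<Rightarrow> (nat \<Rightarrow> 'a \<Rightarrow> real) \<Rightarrow> real \<Rightarrow> (nat \<Rightarrow> 'a \<Rightarrow> real)
     \<Rightarrow> real \<Rightarrow> 'a \<Rightarrow> nat" where
  "num_customers A beta nu D t \<omega> = card {k. in_system A beta nu D t \<omega> k}"

end

theory Submission
  imports Defs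
begin

text \<open>
  The proof avoids point processes and conditions on nothing but the next source variable.
  Let \<open>C u = \<integral>\<^sub>0\<^sup>u (1 - B)\<close> and \<open>E u = exp (- lam (1 - z) C u)\<close>, and let \<open>L\<^sub>n\<close> be
  the last of the first \<open>n\<close> catastrophes that occurs by time \<open>t\<close> (0 if there is none). A customer
  arriving at \<open>x\<close> with service time \<open>b\<close> contributes the factor \<open>z\<close> if
  \<open>L < x \<le> t < x + b\<close>, and 1 otherwise. For a fixed \<open>L\<close> the product of the factors of the first \<open>n\<close>
  customers times \<open>E (t - max x L)\<close>, where \<open>x\<close> is the \<open>n\<close>-th arrival time, is a martingale, so its
  mean is \<open>E (t - L)\<close>. Likewise, with \<open>K v = \<integral>\<^sub>0\<^sup>v nu exp (- nu u) E u du\<close>, the quantity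
  \<open>K (t - s) + E (t - L\<^sub>n) exp (- nu max 0 (t - s))\<close>, where \<open>s\<close> is the \<open>n\<close>-th catastrophe epoch, is a
  martingale with mean \<open>K t + E t exp (- nu t)\<close>, which is the claimed value. Almost surely the arrival
  and catastrophe epochs eventually exceed \<open>t\<close>; the first martingale then equals \<open>z\<^sup>N\<close> and the
  second equals \<open>E (t - L\<^sub>n)\<close>, and dominated convergence concludes.

  Both martingale properties are an integration of an explicit antiderivative against an exponential
  density. Since \<open>B\<close> may jump, this antiderivative is differentiable only off a countable set.
\<close>

section \<open>Antiderivatives with countably many exceptions\<close>

text \<open>Strict positivity lets \<open>G\<close> exceed its value immediately to the right of any
  non-exceptional point. Exceptional points, later the jumps of \<open>B\<close> and a kink, need
  only continuity.\<close>

lemma increasing_countable_exceptions: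
  fixes G :: "real \<Rightarrow> real"
  assumes "a \<le> b" and cont: "continuous_on {a..b} G" and "countable S"
    and der: "\<And>x. x \<in> {a<..<b} - S \<Longrightarrow> \<exists>d>0. (G has_real_derivative d) (at x)"
  shows "G a \<le> G b"
proof (rule ccontr)
  assume "\<not> G a \<le> G b"
  then have lt: "G b < G a" by simp
  have "countable (G ` S)" using \<open>countable S\<close> by simp
  \<comment> \<open>A level avoiding \<open>G ` S\<close>: at the last point where \<open>G\<close> is at least \<open>y\<close>, the derivative exists and is positive.\<close>
  then obtain y where y: "G b < y" "y < G a" "y \<notin> G ` S"
    using open_minus_countable[of "G ` S" "{G b<..<G a}"] lt by (auto simp: greaterThanLessThan_empty_iff2)
  define X where "X = {a..b} \<inter> G -` {y..}"
  have "closed X"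
    unfolding X_def using continuous_closed_preimage[OF cont, of "{y..}"]
    by simp
  moreover have aX: "a \<in> X" using y \<open>a \<le> b\<close> by (auto simp: X_def)
  moreover have bdd: "bdd_above X" by (auto simp: X_def bdd_above_def intro!: exI[of _ b])
  ultimately have sX: "Sup X \<in> X" using closed_contains_Sup[of X] by blast
  define x where "x = Sup X"
  have xab: "x \<in> {a..b}" and xy: "G x \<ge> y" using sX by (auto simp: X_def x_def)
  have above: "G u < y" if "u > x" "u \<le> b" for u
  proof (rule ccontr)
    assume "\<not> G u < y"
    then have "u \<in> X" using that xab by (auto simp: X_def)
    then show False using cSup_upper[OF _ bdd, of u] that by (auto simp: x_def)
  qed
  have xb: "x < b" using xab xy y by (cases "x = b") auto
  have "G x = y"
  proof (rule ccontr)
    assume "G x \<noteq> y"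
    then have "G x > y" using xy by simp
    moreover have "G b \<le> y" using y by simp
    moreover have "continuous_on {x..b} G" by (rule continuous_on_subset[OF cont]) (use xab in auto)
    ultimately obtain u where "x \<le> u" "u \<le> b" "G u = y"
      using IVT2'[of G b y x] xb by auto
    then show False using above[of u] \<open>G x \<noteq> y\<close> by (cases "u = x") auto
  qed
  then have "x \<notin> S" "x \<noteq> a" using y by auto
  then obtain d where d: "d > 0" "(G has_real_derivative d) (at x)"
    using der[of x] xab xb by auto
  from DERIV_pos_inc_right[OF d(2,1)] obtain e where
    e: "e > 0" "\<And>h. h > 0 \<Longrightarrow> h < e \<Longrightarrow> G x < G (x + h)" by blast
  define h where "h = min (e/2) (b - x)"
  have "h > 0" "h < e" "x + h \<le> b" using e(1) xb by (auto simp: h_def)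
  then show False using e(2)[of h] above[of "x + h"] \<open>G x = y\<close> by auto
qed

text \<open>Adding \<open>c * x\<close> with small \<open>c > 0\<close> turns the zero derivative
  into a positive one, which gives monotonicity up to any \<open>e > 0\<close>. The same for
  \<open>- G\<close> gives the reverse inequality.\<close>

lemma constant_countable_exceptions:
  fixes G :: "real \<Rightarrow> real"
  assumes "a \<le> b" and cont: "continuous_on {a..b} G" and "countable S"
    and der: "\<And>x. x \<in> {a<..<b} - S \<Longrightarrow> (G has_real_derivative 0) (at x)"
  shows "G a = G b"
proof -
  have *: "H a \<le> H b"
    if "continuous_on {a..b} H" "\<And>x. x \<in> {a<..<b} - S \<Longrightarrow> (H has_real_derivative 0) (at x)"
    for H :: "real \<Rightarrow> real"
  proof (rule field_le_epsilon)
    fix e :: real assume "e > 0"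
    \<comment> \<open>The added 1 keeps the denominator positive when \<open>a = b\<close>.\<close>
    define c where "c = e / (b - a + 1)"
    have c: "c > 0" "c * (b - a) \<le> e" using \<open>e > 0\<close> \<open>a \<le> b\<close> by (auto simp: c_def field_simps)
    have "H a + c * a \<le> H b + c * b"
    proof (rule increasing_countable_exceptions[OF \<open>a \<le> b\<close> _ \<open>countable S\<close>])
      show "continuous_on {a..b} (\<lambda>x. H x + c * x)" by (intro continuous_intros that)
      show "\<exists>d>0. ((\<lambda>x. H x + c * x) has_real_derivative d) (at x)" if "x \<in> {a<..<b} - S" for x
        using c(1) by (auto intro!: exI[of _ c] derivative_eq_intros \<open>\<And>x. x \<in> {a<..<b} - S \<Longrightarrow> (H has_real_derivative 0) (at x)\<close> that)
    qed
    then show "H a \<le> H b + e" using c(2) by (simp add: algebra_simps)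
  qed
  have "- G a \<le> - G b"
    by (rule *) (auto intro!: continuous_intros cont derivative_eq_intros der)
  with *[OF cont der] show ?thesis by simp
qed

text \<open>\<open>F\<close> minus the indefinite integral of \<open>f\<close> is continuous with
  derivative 0 off \<open>S\<close>, so each of its coordinates is constant.\<close>

lemma integral_countable_exceptions:
  fixes F f :: "real \<Rightarrow> 'b::euclidean_space"
  assumes "a \<le> b" and int: "f integrable_on {a..b}" and cont: "continuous_on {a..b} F"
    and "countable S"
    and der: "\<And>x. x \<in> {a<..<b} - S \<Longrightarrow> (F has_vector_derivative f x) (at x)"
    and isc: "\<And>x. x \<in> {a<..<b} - S \<Longrightarrow> isCont f x"
  shows "integral {a..b} f = F b - F a"
proof (rule euclidean_eqI)
  fix i :: 'b assume "i \<in> Basis"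
  let ?G = "\<lambda>x. F x - integral {a..x} f"
  have "?G a \<bullet> i = ?G b \<bullet> i"
  proof (rule constant_countable_exceptions[OF \<open>a \<le> b\<close> _ \<open>countable S\<close>])
    show "continuous_on {a..b} (\<lambda>x. ?G x \<bullet> i)"
      by (intro continuous_intros cont indefinite_integral_continuous_1 int)
    fix x assume x: "x \<in> {a<..<b} - S"
    have "((\<lambda>u. integral {a..u} f) has_vector_derivative f x) (at x within ({a..b} - {}))"
      by (rule integral_has_vector_derivative_continuous_at[OF int])
        (use x isc[OF x] in \<open>auto intro: continuous_at_imp_continuous_at_within\<close>)
    moreover have "at x within ({a..b} - {}) = at x"
      using x by (intro at_within_interior) (auto simp: interior_atLeastAtMost_real)
    ultimately have "((\<lambda>u. integral {a..u} f) has_vector_derivative f x) (at x)" by simp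
    from has_vector_derivative_diff[OF der[OF x] this]
    have "(?G has_vector_derivative 0) (at x)" by simp
    from bounded_linear.has_vector_derivative[OF bounded_linear_inner_left this, of i]
    show "((\<lambda>x. ?G x \<bullet> i) has_real_derivative 0) (at x)"
      by (simp add: has_real_derivative_iff_has_vector_derivative)
  qed
  then show "integral {a..b} f \<bullet> i = (F b - F a) \<bullet> i"
    by (simp add: inner_diff_left)
qed

text \<open>Beyond \<open>b\<close> the value is \<open>c\<close>, and this tail has probability
  \<open>exp (- l * b)\<close>; on \<open>{0..b}\<close> the density times \<open>f\<close> has
  antiderivative \<open>- H\<close>. Both martingale steps are instances.\<close>

lemma (in prob_space) exponential_expectation_antiderivative:
  fixes f H :: "real \<Rightarrow> complex"
  assumes X: "distributed M lborel X (exponential_density l)" and "0 < l" and "0 \<le> b"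
    and f[measurable]: "f \<in> borel_measurable borel" and bnd: "\<And>y. cmod (f y) \<le> K"
    and cont: "continuous_on {0..b} H" and "countable S"
    and der: "\<And>y. y \<in> {0<..<b} - S \<Longrightarrow>
        (H has_vector_derivative - (of_real (l * exp (- l * y)) * f y)) (at y)"
    and isc: "\<And>y. y \<in> {0<..<b} - S \<Longrightarrow> isCont f y"
    and const: "\<And>y. y > b \<Longrightarrow> f y = c"
  shows "expectation (\<lambda>\<omega>. f (X \<omega>)) = H 0 - H b + c * of_real (exp (- l * b))"
proof -
  let ?d = "exponential_density l"
  let ?e = "\<lambda>y. of_real (l * exp (- l * y)) * f y"
  have Xm[measurable]: "X \<in> borel_measurable M" using X by (simp add: distributed_def)
  \<comment> \<open>Cutting \<open>f\<close> off at \<open>b\<close> separates the tail, which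
    returns as \<open>c\<close> times an indicator.\<close>
  define g where "g y = (if y \<le> b then f y else 0)" for y
  have [measurable]: "g \<in> borel_measurable borel" unfolding g_def by measurable
  have K0: "K \<ge> 0" using bnd[of 0] norm_ge_zero order_trans by blast
  have int: "set_integrable lborel {0..b} ?e"
    unfolding set_integrable_def
  proof (rule integrableI_bounded_set_indicator[where B = "l * K"])
    show "AE x in lborel. x \<in> {0..b} \<longrightarrow> cmod (?e x) \<le> l * K"
    proof (intro AE_I2 impI)
      fix x assume "x \<in> {0..b}"
      then have "l * exp (- l * x) \<le> l * 1" using \<open>0 < l\<close> by (intro mult_left_mono) auto
      then show "cmod (?e x) \<le> l * K"
        using bnd[of x] \<open>0 < l\<close> unfolding norm_mult norm_of_real by (intro mult_mono) auto
    qed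
  qed (auto simp: \<open>0 \<le> b\<close>)
  have "expectation (\<lambda>\<omega>. f (X \<omega>)) = expectation (\<lambda>\<omega>. g (X \<omega>) + c * indicator {\<omega>\<in>space M. b < X \<omega>} \<omega>)"
    by (intro Bochner_Integration.integral_cong) (auto simp: g_def const)
  also have "\<dots> = expectation (\<lambda>\<omega>. g (X \<omega>)) + c * of_real (prob {\<omega>\<in>space M. b < X \<omega>})"
  proof (subst Bochner_Integration.integral_add)
    show "integrable M (\<lambda>\<omega>. g (X \<omega>))"
      by (rule integrable_const_bound[of _ K]) (auto simp: g_def bnd K0)
    show "integrable M (\<lambda>\<omega>. c * indicator {\<omega> \<in> space M. b < X \<omega>} \<omega>)"
      by (rule integrable_const_bound[of _ "cmod c"]) (auto simp: indicator_def)
    have "(\<integral>\<omega>. indicator {\<omega> \<in> space M. b < X \<omega>} \<omega> \<partial>M) = complex_of_real (prob {\<omega> \<in> space M. b < X \<omega>})"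
    proof -
      have "(\<lambda>\<omega>. indicator {\<omega> \<in> space M. b < X \<omega>} \<omega>) = (\<lambda>\<omega>. complex_of_real (indicator {\<omega> \<in> space M. b < X \<omega>} \<omega>))"
        by (auto simp: indicator_def)
      then show ?thesis by (simp add: Int_absorb1 subset_eq)
    qed
    then show "expectation (\<lambda>\<omega>. g (X \<omega>)) + (\<integral>\<omega>. c * indicator {\<omega> \<in> space M. b < X \<omega>} \<omega> \<partial>M)
       = expectation (\<lambda>\<omega>. g (X \<omega>)) + c * of_real (prob {\<omega> \<in> space M. b < X \<omega>})" by simp
  qed
  also have "prob {\<omega>\<in>space M. b < X \<omega>} = exp (- l * b)"
    using exponential_distributedD_gt[OF X \<open>0 \<le> b\<close> \<open>0 < l\<close>] by (simp add: mult.commute)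
  also have "expectation (\<lambda>\<omega>. g (X \<omega>)) = (\<integral>y. ?d y *\<^sub>R g y \<partial>lborel)"
  proof -
    have "expectation (\<lambda>\<omega>. g (X \<omega>)) = (\<integral>y. g y \<partial>distr M lborel X)"
      by (subst integral_distr) (auto simp: measurable_lborel2)
    also have "distr M lborel X = density lborel ?d"
      using X by (simp add: distributed_def)
    also have "(\<integral>y. g y \<partial>density lborel ?d) = (\<integral>y. ?d y *\<^sub>R g y \<partial>lborel)"
      by (rule integral_density) (auto intro: exponential_density_nonneg \<open>0 < l\<close>)
    finally show ?thesis .
  qed
  also have "\<dots> = (LINT y:{0..b}|lborel. ?e y)"
    unfolding set_lebesgue_integral_def
    by (intro Bochner_Integration.integral_cong)
      (auto simp: exponential_density_def g_def indicator_def scaleR_conv_of_real mult.commute)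
  also have "\<dots> = integral {0..b} ?e"
    by (rule set_borel_integral_eq_integral[OF int])
  also have "integral {0..b} ?e = - H b - - H 0"
  proof (rule integral_countable_exceptions[OF \<open>0 \<le> b\<close> set_borel_integral_eq_integral(1)[OF int] _ \<open>countable S\<close>])
    show "continuous_on {0..b} (\<lambda>x. - H x)" by (intro continuous_intros cont)
    fix y assume y: "y \<in> {0<..<b} - S"
    show "((\<lambda>x. - H x) has_vector_derivative ?e y) (at y)"
      using has_vector_derivative_minus[OF der[OF y]] by simp
    show "isCont ?e y" by (intro continuous_intros isc y)
  qed
  finally show ?thesis by simp
qed

text \<open>For negative \<open>u\<close> the interval \<open>{0..u}\<close> is empty, so
  \<open>u\<close> may be replaced by \<open>max 0 u\<close>; this gives continuity across 0 as
  well.\<close>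

lemma isCont_integral_upper:
  fixes f :: "real \<Rightarrow> 'b::banach"
  assumes int: "\<And>T. f integrable_on {0..T}"
  shows "isCont (\<lambda>u. integral {0..u} f) x"
proof -
  define T where "T = \<bar>x\<bar> + 1"
  have "continuous_on {-T<..<T} (\<lambda>u. integral {0..max 0 u} f)"
    by (rule continuous_on_compose2[OF indefinite_integral_continuous_1[OF int[of T]]])
      (auto intro!: continuous_intros)
  moreover have "integral {0..max 0 u} f = integral {0..u} f" for u
    by (cases "u \<ge> 0") (auto simp: max_def)
  ultimately have "continuous_on {-T<..<T} (\<lambda>u. integral {0..u} f)" by simp
  then show ?thesis
    by (rule continuous_on_interior) (auto simp: T_def)
qed

lemma integral_upper_has_vector_derivative:
  fixes f :: "real \<Rightarrow> 'b::banach"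
  assumes int: "\<And>T. f integrable_on {0..T}" and "0 < x" "isCont f x"
  shows "((\<lambda>u. integral {0..u} f) has_vector_derivative f x) (at x)"
proof -
  have "((\<lambda>u. integral {0..u} f) has_vector_derivative f x) (at x within ({0..x+1} - {}))"
    by (rule integral_has_vector_derivative_continuous_at[OF int])
      (use assms in \<open>auto intro: continuous_at_imp_continuous_at_within\<close>)
  moreover have "at x within ({0..x+1} - {}) = at x"
    using \<open>0 < x\<close> by (intro at_within_interior) auto
  ultimately show ?thesis by simp
qed

section \<open>Independent and exponential random variables\<close>

context prob_space
begin

text \<open>Fubini's theorem for the product of the two laws, with a bound asked only at attained
  values.\<close>

lemma expectation_indep_var_pair:
  fixes F :: "_ \<Rightarrow> 'c::{banach, second_countable_topology}"
  assumes ind: "indep_var N X L Y" and F[measurable]: "F \<in> borel_measurable (N \<Otimes>\<^sub>M L)"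
    and bnd: "\<And>\<omega> \<omega>'. \<omega> \<in> space M \<Longrightarrow> \<omega>' \<in> space M \<Longrightarrow> norm (F (X \<omega>, Y \<omega>')) \<le> K"
  shows "expectation (\<lambda>\<omega>. F (X \<omega>, Y \<omega>)) = expectation (\<lambda>\<omega>. expectation (\<lambda>\<omega>'. F (X \<omega>, Y \<omega>')))"
proof -
  have X[measurable]: "X \<in> measurable M N" and Y[measurable]: "Y \<in> measurable M L"
    and D: "distr M N X \<Otimes>\<^sub>M distr M L Y = distr M (N \<Otimes>\<^sub>M L) (\<lambda>\<omega>. (X \<omega>, Y \<omega>))"
    using ind unfolding indep_var_distribution_eq by auto
  interpret DX: prob_space "distr M N X" by (rule prob_space_distr) simp
  interpret DY: prob_space "distr M L Y" by (rule prob_space_distr) simp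
  interpret P: pair_prob_space "distr M N X" "distr M L Y" ..
  \<comment> \<open>Truncation gives a bounded function on the whole product space that agrees with
    \<open>F\<close> at attained pairs.\<close>
  define F' where "F' p = (if norm (F p) \<le> \<bar>K\<bar> then F p else 0)" for p
  have [measurable]: "F' \<in> borel_measurable (N \<Otimes>\<^sub>M L)" unfolding F'_def by measurable
  have eq: "F' (X \<omega>, Y \<omega>') = F (X \<omega>, Y \<omega>')" if "\<omega> \<in> space M" "\<omega>' \<in> space M" for \<omega> \<omega>'
    using order_trans[OF bnd[OF that] abs_ge_self] by (simp add: F'_def)
  have "expectation (\<lambda>\<omega>. F (X \<omega>, Y \<omega>)) = expectation (\<lambda>\<omega>. F' (X \<omega>, Y \<omega>))"
    by (intro Bochner_Integration.integral_cong) (auto simp: eq)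
  also have "\<dots> = integral\<^sup>L (distr M N X \<Otimes>\<^sub>M distr M L Y) F'"
    unfolding D by (subst integral_distr) auto
  also have "\<dots> = (\<integral>x. (\<integral>y. F' (x, y) \<partial>distr M L Y) \<partial>distr M N X)"
  proof (rule P.integral_fst'[symmetric])
    show "integrable (distr M N X \<Otimes>\<^sub>M distr M L Y) F'"
      by (rule P.integrable_const_bound[of _ "\<bar>K\<bar>"]) (auto simp: F'_def)
  qed
  also have "\<dots> = (\<integral>x. expectation (\<lambda>\<omega>'. F' (x, Y \<omega>')) \<partial>distr M N X)"
    by (intro Bochner_Integration.integral_cong refl integral_distr) auto
  also have "\<dots> = expectation (\<lambda>\<omega>. expectation (\<lambda>\<omega>'. F' (X \<omega>, Y \<omega>')))"
    by (rule integral_distr) auto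
  also have "\<dots> = expectation (\<lambda>\<omega>. expectation (\<lambda>\<omega>'. F (X \<omega>, Y \<omega>')))"
    by (intro Bochner_Integration.integral_cong refl eq)
  finally show ?thesis .
qed

lemma AE_exponential_pos:
  assumes X: "distributed M lborel X (exponential_density l)" and "0 < l"
  shows "AE \<omega> in M. 0 < X \<omega>"
proof -
  have [measurable]: "X \<in> borel_measurable M" using X by (simp add: distributed_def)
  have "prob {\<omega> \<in> space M. X \<omega> \<le> 0} = 0"
    using exponential_distributedD_le[OF X order_refl \<open>0 < l\<close>] by simp
  then have "AE \<omega> in M. \<not> X \<omega> \<le> 0"
    by (subst (asm) prob_eq_0) (auto elim: eventually_mono)
  then show ?thesis by (simp add: not_le)
qed

text \<open>Any \<open>n\<close> of the variables are all at most \<open>t\<close> with probability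
  \<open>q ^ n\<close>, where \<open>q < 1\<close>. A single gap longer than \<open>t\<close>, the
  others being positive, already pushes the epochs past \<open>t\<close>.\<close>

lemma AE_ex_exponential_gt:
  assumes ind: "indep_vars (\<lambda>_. borel) X I" and "infinite I" "countable I"
    and X: "\<And>i. i \<in> I \<Longrightarrow> distributed M lborel (X i) (exponential_density l)" and "0 < l" "0 \<le> t"
  shows "AE \<omega> in M. \<exists>i\<in>I. t < X i \<omega>"
proof -
  have [measurable]: "X i \<in> borel_measurable M" if "i \<in> I" for i
    using X[OF that] by (simp add: distributed_def)
  define q where "q = 1 - exp (- t * l)"
  have q: "0 \<le> q" "q < 1" using assms by (auto simp: q_def)
  let ?N = "{\<omega> \<in> space M. \<forall>i\<in>I. X i \<omega> \<le> t}"
  have "I \<noteq> {}" using \<open>infinite I\<close> by auto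
  then have "?N = (\<Inter>i\<in>I. {\<omega> \<in> space M. X i \<omega> \<le> t})" by auto
  also have "\<dots> \<in> events"
    by (rule sets.countable_INT'[OF \<open>countable I\<close> \<open>I \<noteq> {}\<close>]) auto
  finally have [measurable]: "?N \<in> events" .
  have "prob ?N \<le> q ^ n" if "n > 0" for n
  proof -
    obtain J where J: "finite J" "card J = n" "J \<subseteq> I"
      using infinite_arbitrarily_large[OF \<open>infinite I\<close>] by blast
    have le_q: "prob (X i -` {..t} \<inter> space M) = q" if "i \<in> J" for i
      using exponential_distributedD_le[OF X \<open>0 \<le> t\<close> \<open>0 < l\<close>, of i] that J
      by (auto simp: q_def vimage_def Int_def conj_commute)
    have "J \<noteq> {}" using J that by auto
    have "prob ?N \<le> prob (\<Inter>i\<in>J. X i -` {..t} \<inter> space M)"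
      using \<open>J \<noteq> {}\<close> J
      by (intro finite_measure_mono sets.finite_INT) (auto intro!: measurable_sets[of _ _ borel])
    also have "\<dots> = (\<Prod>i\<in>J. prob (X i -` {..t} \<inter> space M))"
      by (rule indep_varsD_finite[OF indep_vars_subset[OF ind \<open>J \<subseteq> I\<close>] \<open>J \<noteq> {}\<close> \<open>finite J\<close>]) auto
    also have "\<dots> = q ^ n" using J by (simp add: le_q)
    finally show ?thesis .
  qed
  moreover have "(\<lambda>n. q ^ n) \<longlonglongrightarrow> 0" using q by (intro LIMSEQ_power_zero) auto
  ultimately have "prob ?N \<le> 0"
    by (intro tendsto_lowerbound[of "\<lambda>n. q ^ n" 0 sequentially])
      (auto intro!: eventually_mono[OF eventually_gt_at_top[of 0]])
  then have "prob ?N = 0" using measure_nonneg[of M ?N] by linarith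
  then have "AE \<omega> in M. \<not> (\<forall>i\<in>I. X i \<omega> \<le> t)"
    by (subst (asm) prob_eq_0) (auto elim: eventually_mono)
  then show ?thesis by (simp add: not_le)
qed

end

section \<open>The queue\<close>

text \<open>Without catastrophes (\<open>nu = 0\<close>) the variables \<open>D i\<close> are arbitrary and have to be ignored.\<close>

fun last_catastrophe :: "real \<Rightarrow> real \<Rightarrow> (nat \<Rightarrow> real) \<Rightarrow> nat \<Rightarrow> real" where
  "last_catastrophe nu t d 0 = 0"
| "last_catastrophe nu t d (Suc n) =
     (if nu \<noteq> 0 \<and> (\<Sum>i<Suc n. d i) \<le> t then \<Sum>i<Suc n. d i else last_catastrophe nu t d n)"

lemma last_catastrophe_cong:
  "(\<And>i. i < n \<Longrightarrow> d i = d' i) \<Longrightarrow> last_catastrophe nu t d n = last_catastrophe nu t d' n"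
  by (induction n) (auto intro!: sum.cong)

lemma borel_measurable_last_catastrophe[measurable (raw)]:
  assumes "\<And>i. i < n \<Longrightarrow> (\<lambda>x. d x i) \<in> borel_measurable N"
  shows "(\<lambda>x. last_catastrophe nu t (d x) n) \<in> borel_measurable N"
  using assms
proof (induction n)
  case (Suc n)
  have [measurable]: "(\<lambda>x. \<Sum>i<Suc n. d x i) \<in> borel_measurable N"
    using Suc.prems by (intro borel_measurable_sum) auto
  have [measurable]: "(\<lambda>x. last_catastrophe nu t (d x) n) \<in> borel_measurable N"
    using Suc by simp
  show ?case unfolding last_catastrophe.simps by measurable
qed simp

text \<open>Positive gaps make the epochs increase, so the latest one not exceeding \<open>t\<close>
  dominates all earlier ones; \<open>0 < x\<close> covers the value 0 used when there is
  none.\<close>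

lemma less_last_catastrophe_iff:
  assumes "\<And>i. 0 < d i" "0 < x"
  shows "last_catastrophe nu t d n < x \<longleftrightarrow>
    (nu = 0 \<or> (\<forall>j<n. (\<Sum>i<Suc j. d i) \<le> t \<longrightarrow> (\<Sum>i<Suc j. d i) < x))"
proof (induction n)
  case (Suc n)
  let ?s = "\<lambda>j. \<Sum>i<Suc j. d i"
  have mono: "?s j \<le> ?s n" if "j < Suc n" for j
    using that assms by (intro sum_mono2) (auto intro: less_imp_le)
  show ?case
  proof (cases "nu \<noteq> 0 \<and> ?s n \<le> t")
    case True
    then have "last_catastrophe nu t d (Suc n) = ?s n" by simp
    then show ?thesis using True mono by (metis lessI le_less_trans)
  next
    case False
    then have "last_catastrophe nu t d (Suc n) = last_catastrophe nu t d n"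
      unfolding last_catastrophe.simps by argo
    then show ?thesis using Suc False by (metis less_Suc_eq)
  qed
qed (use assms in auto)

section \<open>The model at a fixed time \<open>t\<close> and argument \<open>z\<close>\<close>

locale catastrophe_queue = prob_space M for M :: "'a measure" +
  fixes A beta D :: "nat \<Rightarrow> 'a \<Rightarrow> real"
    and B :: "real \<Rightarrow> real"
    and lam nu t :: real
    and z :: complex
  assumes lam: "lam > 0" and nu: "nu \<ge> 0"
    and indep: "indep_vars (\<lambda>_. borel)
          (\<lambda>s. case s of Arr i \<Rightarrow> A i | Serv i \<Rightarrow> beta i | Cat i \<Rightarrow> D i) UNIV"
    and arr: "\<And>i. distributed M lborel (A i) (exponential_density lam)"
    and cat: "\<And>i. nu > 0 \<Longrightarrow> distributed M lborel (D i) (exponential_density nu)"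
    and serv_cdf: "\<And>i x. measure M {\<omega> \<in> space M. beta i \<omega> \<le> x} = B x"
    and t: "t \<ge> 0" and z: "cmod z \<le> 1"
begin

abbreviation source :: "mgi_src \<Rightarrow> 'a \<Rightarrow> real" where
  "source s \<equiv> (case s of Arr i \<Rightarrow> A i | Serv i \<Rightarrow> beta i | Cat i \<Rightarrow> D i)"

lemma source_measurable: "source s \<in> borel_measurable M"
  using indep unfolding indep_vars_def by blast

lemma measurable_sources[measurable]:
  "A i \<in> borel_measurable M" "beta i \<in> borel_measurable M" "D i \<in> borel_measurable M"
  using source_measurable[of "Arr i"] source_measurable[of "Serv i"] source_measurable[of "Cat i"]
  by simp_all

lemma B_nonneg: "0 \<le> B x" and B_le_1: "B x \<le> 1"
  unfolding serv_cdf[of 0, symmetric] by (simp_all add: measure_nonneg)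

lemma mono_B: "mono B"
proof (rule monoI)
  fix x y :: real assume "x \<le> y"
  then show "B x \<le> B y"
    unfolding serv_cdf[of 0, symmetric] by (intro finite_measure_mono) auto
qed

lemma borel_measurable_B[measurable]: "B \<in> borel_measurable borel"
  by (rule borel_measurable_mono) (rule mono_B)

lemma prob_serv_gt: "prob {\<omega> \<in> space M. x < beta i \<omega>} = 1 - B x"
proof -
  have "{\<omega> \<in> space M. x < beta i \<omega>} = space M - {\<omega> \<in> space M. beta i \<omega> \<le> x}" by auto
  then show ?thesis by (simp add: prob_compl serv_cdf)
qed

section \<open>The functions in the closed formula\<close>

definition C :: "real \<Rightarrow> real" where "C u = integral {0..u} (\<lambda>x. 1 - B x)"
text \<open>For \<open>u \<ge> 0\<close>, the generating function at time \<open>u\<close> of the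
  queue without catastrophes, started empty.\<close>

definition E :: "real \<Rightarrow> complex" where "E u = exp (- of_real lam * (1 - z) * of_real (C u))"
text \<open>Looking back from \<open>t\<close>, the age of the last catastrophe has density
  \<open>nu * exp (- nu * u)\<close>; averaging \<open>E\<close> against it yields the integral term
  of the formula.\<close>

definition K :: "real \<Rightarrow> complex" where "K v = integral {0..v} (\<lambda>u. of_real (nu * exp (- nu * u)) * E u)"

lemma integrable_tail: "(\<lambda>x. 1 - B x) integrable_on {0..u}"
  by (intro integrable_diff integrable_on_mono_on integrable_const_ivl)
    (use mono_B in \<open>auto simp: mono_def mono_on_def\<close>)

lemma C_nonneg: "0 \<le> C u"
  unfolding C_def by (intro integral_nonneg integrable_tail) (simp add: B_le_1)

lemma C_nonpos_arg: "u \<le> 0 \<Longrightarrow> C u = 0"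
  unfolding C_def by (cases "u = 0") auto

lemma isCont_C: "isCont C u"
  unfolding C_def[abs_def] by (intro isCont_integral_upper integrable_tail)

text \<open>This makes the factor \<open>Phi\<close> equal to 1 once the arrivals have passed
  \<open>t\<close>.\<close>

lemma E_nonpos_arg: "u \<le> 0 \<Longrightarrow> E u = 1"
  by (simp add: E_def C_nonpos_arg)

text \<open>The exponent has real part \<open>- lam * (1 - Re z) * C u\<close>, which is
  nonpositive.\<close>

lemma norm_E_le: "cmod (E u) \<le> 1"
proof -
  have "Re z \<le> 1" using z complex_Re_le_cmod[of z] by linarith
  then have "0 \<le> lam * (1 - Re z) * C u" using lam C_nonneg[of u] by simp
  then show ?thesis unfolding E_def norm_exp_eq_Re by simp
qed

lemma isCont_E: "isCont E u"
  unfolding E_def[abs_def] by (intro continuous_intros isCont_C)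

lemma E_has_vector_derivative:
  assumes "0 < u" "isCont B u"
  shows "(E has_vector_derivative - (of_real (lam * (1 - B u)) * (1 - z) * E u)) (at u)"
proof -
  have "(C has_vector_derivative (1 - B u)) (at u)"
    unfolding C_def[abs_def]
    by (rule integral_upper_has_vector_derivative)
      (use assms integrable_tail in \<open>auto intro!: continuous_intros\<close>)
  then have "((\<lambda>u. complex_of_real (C u)) has_vector_derivative of_real (1 - B u)) (at u)"
    by (rule bounded_linear.has_vector_derivative[OF bounded_linear_of_real])
  from has_vector_derivative_mult_right[OF this, of "- of_real lam * (1 - z)"]
  have "((\<lambda>u. - of_real lam * (1 - z) * of_real (C u)) has_vector_derivative
      - of_real lam * (1 - z) * of_real (1 - B u)) (at u)" .
  from field_vector_diff_chain_at[OF this DERIV_exp]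
  show ?thesis by (simp add: E_def[abs_def] o_def mult_ac)
qed

lemma continuous_K_integrand: "continuous_on S (\<lambda>u. of_real (nu * exp (- nu * u)) * E u)"
  by (intro continuous_intros continuous_at_imp_continuous_on ballI isCont_E)

lemma isCont_K: "isCont K v"
  unfolding K_def[abs_def]
  by (intro isCont_integral_upper integrable_continuous_real continuous_K_integrand)

lemma K_has_vector_derivative:
  assumes "0 < v"
  shows "(K has_vector_derivative of_real (nu * exp (- nu * v)) * E v) (at v)"
  unfolding K_def[abs_def]
proof (rule integral_upper_has_vector_derivative[OF _ assms])
  show "isCont (\<lambda>u. of_real (nu * exp (- nu * u)) * E u) v"
    by (intro continuous_intros isCont_E)
qed (intro integrable_continuous_real continuous_K_integrand)

lemma K_nonpos_arg: "v \<le> 0 \<Longrightarrow> K v = 0"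
  unfolding K_def by (cases "v = 0") auto

text \<open>\<open>E\<close> is bounded by 1, and the exponential density integrates to at most
  1.\<close>

lemma norm_K_le: "cmod (K v) \<le> 1"
proof (cases "v \<ge> 0")
  case True
  have int: "((\<lambda>u. nu * exp (- nu * u)) has_integral (- exp (- nu * v) - - exp (- nu * 0))) {0..v}"
    using True by (intro fundamental_theorem_of_calculus)
      (auto intro!: derivative_eq_intros simp: has_real_derivative_iff_has_vector_derivative[symmetric])
  have "cmod (K v) \<le> integral {0..v} (\<lambda>u. nu * exp (- nu * u))"
    unfolding K_def
  proof (rule integral_norm_bound_integral)
    fix u
    show "cmod (of_real (nu * exp (- nu * u)) * E u) \<le> nu * exp (- nu * u)"
      unfolding norm_mult norm_of_real
      using mult_left_mono[OF norm_E_le[of u], of "nu * exp (- nu * u)"] nu by simp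
    show "(\<lambda>u. nu * exp (- nu * u)) integrable_on {0..v}" using int by blast
  qed (intro integrable_continuous_real continuous_K_integrand)
  also have "\<dots> = 1 - exp (- nu * v)" using integral_unique[OF int] by simp
  finally show ?thesis by (rule order_trans) simp
qed (simp add: K_nonpos_arg)

lemma borel_measurable_E[measurable]: "E \<in> borel_measurable borel"
  and borel_measurable_K[measurable]: "K \<in> borel_measurable borel"
  by (intro borel_measurable_continuous_onI continuous_at_imp_continuous_on ballI isCont_E isCont_K)+

text \<open>The inequality \<open>s < x\<close> is strict because a catastrophe at the very instant
  of arrival removes the customer.\<close>

definition mark :: "real \<Rightarrow> real \<Rightarrow> real \<Rightarrow> complex" where
  "mark s x b = (if s < x \<and> x \<le> t \<and> t < x + b then z else 1)"

text \<open>The average of \<open>mark\<close> over the service time, written with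
  \<open>1 - z\<close> to match the derivative of \<open>E\<close>.\<close>

definition mean_mark :: "real \<Rightarrow> real \<Rightarrow> complex" where
  "mean_mark s x = (if s < x \<and> x \<le> t then 1 - (1 - z) * of_real (1 - B (t - x)) else 1)"

text \<open>Conditional mean of the marks of all customers arriving after \<open>w\<close>, when the last catastrophe by time \<open>t\<close> is at \<open>s\<close>.\<close>

definition Phi :: "real \<Rightarrow> real \<Rightarrow> complex" where
  "Phi s w = E (t - max w s)"

lemma norm_mark_le: "cmod (mark s x b) \<le> 1"
  using z by (simp add: mark_def)

lemma norm_Phi_le: "cmod (Phi s w) \<le> 1"
  by (simp add: Phi_def norm_E_le)

lemma borel_measurable_mark[measurable (raw)]:
  assumes [measurable]: "f \<in> borel_measurable N" "g \<in> borel_measurable N" "h \<in> borel_measurable N"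
  shows "(\<lambda>x. mark (f x) (g x) (h x)) \<in> borel_measurable N"
  unfolding mark_def by measurable

lemma borel_measurable_Phi[measurable (raw)]:
  assumes [measurable]: "f \<in> borel_measurable N" "g \<in> borel_measurable N"
  shows "(\<lambda>x. Phi (f x) (g x)) \<in> borel_measurable N"
  unfolding Phi_def by measurable

lemma borel_measurable_mean_mark[measurable]: "mean_mark s \<in> borel_measurable borel"
  unfolding mean_mark_def[abs_def] by measurable

lemma expectation_mark: "expectation (\<lambda>\<omega>. mark s x (beta i \<omega>)) = mean_mark s x"
proof (cases "s < x \<and> x \<le> t")
  case True
  let ?N = "{\<omega> \<in> space M. t - x < beta i \<omega>}"
  have "expectation (\<lambda>\<omega>. mark s x (beta i \<omega>)) =
      expectation (\<lambda>\<omega>. 1 - (1 - z) * of_real (indicator ?N \<omega>))"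
    using True by (intro Bochner_Integration.integral_cong) (auto simp: mark_def indicator_def)
  also have "\<dots> = 1 - (1 - z) * of_real (prob ?N)"
  proof -
    have "integrable M (\<lambda>\<omega>. (1 - z) * of_real (indicator ?N \<omega>))"
      by (intro integrable_mult_right integrable_of_real integrable_real_indicator) (auto simp: emeasure_eq_measure)
    then show ?thesis by (simp add: prob_space Int_absorb1 subset_eq)
  qed
  finally show ?thesis using True by (simp add: mean_mark_def prob_serv_gt)
qed (auto simp: mark_def mean_mark_def prob_space)

text \<open>When not 1, \<open>mean_mark\<close> is the convex combination of 1 and \<open>z\<close>
  with weights \<open>B (t - x)\<close> and \<open>1 - B (t - x)\<close>.\<close>

lemma norm_mean_mark_le: "cmod (mean_mark s x) \<le> 1"
proof -
  have "cmod (of_real (B y) + z * of_real (1 - B y)) \<le> B y + 1 * (1 - B y)" for y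
    using z B_nonneg[of y] B_le_1[of y]
    by (intro order_trans[OF norm_triangle_ineq] add_mono)
      (auto simp: norm_mult simp flip: of_real_diff intro!: mult_left_le_one_le)
  from this[of "t - x"] show ?thesis
    by (simp add: mean_mark_def algebra_simps)
qed

text \<open>The step of the arrival martingale after the service time has been averaged out; only
  the interarrival time is integrated.\<close>

lemma expectation_mean_mark_Phi:
  "expectation (\<lambda>\<omega>. mean_mark s (x + A i \<omega>) * Phi s (x + A i \<omega>)) = Phi s x"
proof -
  \<comment> \<open>For \<open>y > b\<close> the arrival falls after \<open>t\<close>, where both
    factors are 1.\<close>
  define b where "b = max 0 (t - x)"
  define f where "f y = mean_mark s (x + y) * Phi s (x + y)" for y
  define H where "H y = of_real (exp (- lam * y)) * Phi s (x + y)" for y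
  \<comment> \<open>The kink of \<open>Phi\<close> at \<open>x + y = s\<close>, and the reflected
    jumps of \<open>B\<close>.\<close>
  define S where "S = insert (s - x) ((\<lambda>u. t - x - u) ` {u. \<not> isCont B u})"
  have "expectation (\<lambda>\<omega>. f (A i \<omega>)) = H 0 - H b + 1 * of_real (exp (- lam * b))"
  proof (rule exponential_expectation_antiderivative[OF arr lam, where K = 1 and S = S])
    show "0 \<le> b" by (simp add: b_def)
    show "f \<in> borel_measurable borel" unfolding f_def[abs_def] by measurable
    show "cmod (f y) \<le> 1" for y
      unfolding f_def norm_mult by (intro mult_le_one norm_mean_mark_le norm_Phi_le norm_ge_zero)
    have "isCont (\<lambda>y. E (t - max (x + y) s)) y" for y
      by (rule isCont_o2[OF _ isCont_E]) (intro continuous_intros)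
    then show "continuous_on {0..b} H"
      unfolding H_def Phi_def by (intro continuous_intros continuous_at_imp_continuous_on ballI)
    show "countable S" using mono_ctble_discont[OF mono_B] by (simp add: S_def)
    show "f y = 1" if "y > b" for y
      using that by (auto simp: f_def mean_mark_def Phi_def b_def E_nonpos_arg)
    fix y assume y: "y \<in> {0<..<b} - S"
    then have yt: "0 < y" "x + y < t" by (auto simp: b_def max_def split: if_splits)
    have cont: "isCont B (t - x - y)"
      using y unfolding S_def by (auto simp: image_iff)
    have exp': "((\<lambda>y. complex_of_real (exp (- lam * y))) has_vector_derivative
        of_real (- lam * exp (- lam * y))) (at y)"
      by (rule bounded_linear.has_vector_derivative[OF bounded_linear_of_real])
        (auto simp flip: has_real_derivative_iff_has_vector_derivative intro!: derivative_eq_intros)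
    have B': "isCont (\<lambda>u. B (t - x - u)) y"
      by (rule isCont_o2[where f = "\<lambda>u. t - x - u"]) (intro continuous_intros cont)+
    \<comment> \<open>Before \<open>s\<close> the mean mark is 1 and \<open>Phi\<close> is constant,
      so only the exponential varies; after \<open>s\<close> the product rule is needed.\<close>
    consider "x + y < s" | "s < x + y" using y by (cases "x + y" s rule: linorder_cases) (auto simp: S_def)
    then have "(H has_vector_derivative - (of_real (lam * exp (- lam * y)) * f y)) (at y) \<and> isCont f y"
    proof cases
      case 1
      let ?U = "{..<s - x}"
      have y_in: "y \<in> ?U" using 1 by simp
      have f: "f u = E (t - s)" if "u \<in> ?U" for u
        using that by (auto simp: f_def mean_mark_def Phi_def max_def)
      have "\<forall>\<^sub>F u in nhds y. f u = E (t - s)"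
        using eventually_nhds_in_open[OF _ y_in] by (rule eventually_mono) (auto simp: f)
      then have "isCont f y" by (subst isCont_cong) auto
      moreover have "((\<lambda>y. of_real (exp (- lam * y)) * E (t - s)) has_vector_derivative
          of_real (- lam * exp (- lam * y)) * E (t - s)) (at y)"
        by (rule has_vector_derivative_mult_left[OF exp'])
      then have "(H has_vector_derivative of_real (- lam * exp (- lam * y)) * E (t - s)) (at y)"
        by (rule has_vector_derivative_transform_within_open[of _ _ _ ?U])
          (use y_in in \<open>auto simp: H_def Phi_def max_def\<close>)
      ultimately show ?thesis using f[OF y_in] by simp
    next
      case 2
      let ?U = "{s - x<..<t - x}"
      have y_in: "y \<in> ?U" using 2 yt by auto
      have f: "f u = (1 - (1 - z) * of_real (1 - B (t - x - u))) * E (t - x - u)" if "u \<in> ?U" for u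
        using that by (auto simp: f_def mean_mark_def Phi_def max_def diff_diff_eq)
      have "\<forall>\<^sub>F u in nhds y. f u = (1 - (1 - z) * of_real (1 - B (t - x - u))) * E (t - x - u)"
        using eventually_nhds_in_open[OF _ y_in] by (rule eventually_mono) (auto simp: f)
      moreover have "isCont (\<lambda>u. (1 - (1 - z) * of_real (1 - B (t - x - u))) * E (t - x - u)) y"
        by (intro continuous_intros isCont_o2[OF _ isCont_E] B')
      ultimately have "isCont f y" by (subst isCont_cong) auto
      moreover have "((\<lambda>u. E (t - x - u)) has_vector_derivative
          (-1) *\<^sub>R - (of_real (lam * (1 - B (t - x - y))) * (1 - z) * E (t - x - y))) (at y)"
        using vector_diff_chain_at[of "\<lambda>u. t - x - u" "-1" y E] E_has_vector_derivative[OF _ cont] yt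
        by (force simp: o_def intro!: derivative_eq_intros)
      \<comment> \<open>The two terms combine: \<open>- lam\<close> plus
        \<open>lam * (1 - B) * (1 - z)\<close>, with \<open>B\<close> taken at
        \<open>t - x - y\<close>, is \<open>- lam\<close> times the mean mark.\<close>
      from has_vector_derivative_mult[OF exp' this]
      have "((\<lambda>u. of_real (exp (- lam * u)) * E (t - x - u)) has_vector_derivative
         - (of_real (lam * exp (- lam * y)) * f y)) (at y)"
        by (rule has_vector_derivative_eq_rhs) (simp add: f[OF y_in] algebra_simps)
      then have "(H has_vector_derivative - (of_real (lam * exp (- lam * y)) * f y)) (at y)"
        by (rule has_vector_derivative_transform_within_open[of _ _ _ ?U])
          (use y_in in \<open>auto simp: H_def Phi_def max_def diff_diff_eq\<close>)
      ultimately show ?thesis by simp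
    qed
    then show "(H has_vector_derivative - (of_real (lam * exp (- lam * y)) * f y)) (at y)"
      and "isCont f y" by auto
  qed
  \<comment> \<open>\<open>H b\<close> cancels the tail term, leaving
    \<open>H 0 = Phi s x\<close>.\<close>
  moreover have "t - max (x + b) s \<le> 0" by (auto simp: b_def max_def)
  then have "H b = of_real (exp (- lam * b))" by (simp add: H_def Phi_def E_nonpos_arg)
  ultimately show ?thesis by (simp add: f_def H_def)
qed

section \<open>The two martingales\<close>

text \<open>Sources over disjoint index sets are independent, and \<open>X\<close>, \<open>Y\<close>
  factor through them; hence \<open>X\<close> may be frozen while \<open>Y\<close> is
  averaged.\<close>

lemma expectation_disjoint_sources:
  fixes F :: "_ \<Rightarrow> complex"
  assumes "I \<inter> J = {}" and f[measurable]: "f \<in> measurable (PiM I (\<lambda>_. borel)) N"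
    and g[measurable]: "g \<in> measurable (PiM J (\<lambda>_. borel)) N'"
    and X: "\<And>\<omega>. X \<omega> = f (\<lambda>s\<in>I. source s \<omega>)" and Y: "\<And>\<omega>. Y \<omega> = g (\<lambda>s\<in>J. source s \<omega>)"
    and F[measurable]: "F \<in> borel_measurable (N \<Otimes>\<^sub>M N')"
    and bnd: "\<And>\<omega> \<omega>'. cmod (F (X \<omega>, Y \<omega>')) \<le> c"
  shows "expectation (\<lambda>\<omega>. F (X \<omega>, Y \<omega>)) = expectation (\<lambda>\<omega>. expectation (\<lambda>\<omega>'. F (X \<omega>, Y \<omega>')))"
proof -
  have "indep_var (PiM I (\<lambda>_. borel)) (\<lambda>\<omega>. \<lambda>s\<in>I. source s \<omega>) (PiM J (\<lambda>_. borel)) (\<lambda>\<omega>. \<lambda>s\<in>J. source s \<omega>)"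
    by (rule indep_var_restrict[OF indep assms(1)]) auto
  from expectation_indep_var_pair[OF this, where F = "\<lambda>p. F (f (fst p), g (snd p))" and K = c]
  show ?thesis using bnd by (simp add: X Y)
qed

text \<open>The service time is averaged first, with the arrival epoch frozen, then the interarrival
  time.\<close>

lemma expectation_mark_Phi:
  "expectation (\<lambda>\<omega>. mark s (x + A i \<omega>) (beta i \<omega>) * Phi s (x + A i \<omega>)) = Phi s x"
proof -
  let ?F = "\<lambda>(a, b). mark s (x + a) b * Phi s (x + a)"
  have "expectation (\<lambda>\<omega>. ?F (A i \<omega>, beta i \<omega>)) = expectation (\<lambda>\<omega>. expectation (\<lambda>\<omega>'. ?F (A i \<omega>, beta i \<omega>')))"
    by (rule expectation_disjoint_sources[where I = "{Arr i}" and J = "{Serv i}" and N = borel and N' = borel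
          and f = "\<lambda>y. y (Arr i)" and g = "\<lambda>y. y (Serv i)" and c = 1])
      (auto simp: norm_mult intro!: mult_le_one norm_mark_le norm_Phi_le)
  then show ?thesis by (simp add: expectation_mark expectation_mean_mark_Phi)
qed

abbreviation L :: "nat \<Rightarrow> 'a \<Rightarrow> real" where
  "L n \<omega> \<equiv> last_catastrophe nu t (\<lambda>i. D i \<omega>) n"

abbreviation marks :: "nat \<Rightarrow> real \<Rightarrow> 'a \<Rightarrow> complex" where
  "marks n s \<omega> \<equiv> \<Prod>k<n. mark s (\<Sum>i<Suc k. A i \<omega>) (beta k \<omega>)"

lemma norm_marks_le: "cmod (marks n s \<omega>) \<le> 1"
  unfolding prod_norm[symmetric] by (intro prod_le_1) (auto simp: norm_mark_le)

text \<open>Customer \<open>n\<close> is averaged out given the earlier customers and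
  \<open>L m\<close>; this removes its mark and moves \<open>Phi\<close> back by one
  arrival.\<close>

lemma expectation_arrivals:
  "expectation (\<lambda>\<omega>. marks n (L m \<omega>) \<omega> * Phi (L m \<omega>) (\<Sum>i<n. A i \<omega>)) =
   expectation (\<lambda>\<omega>. Phi (L m \<omega>) 0)"
proof (induction n)
  case (Suc n)
  let ?F = "\<lambda>(u, v). fst u * (mark (snd (snd u)) (fst (snd u) + fst v) (snd v) *
      Phi (snd (snd u)) (fst (snd u) + fst v))"
  let ?X = "\<lambda>\<omega>. (marks n (L m \<omega>) \<omega>, \<Sum>i<n. A i \<omega>, L m \<omega>)"
  let ?Y = "\<lambda>\<omega>. (A n \<omega>, beta n \<omega>)"
  let ?I = "range Cat \<union> Arr ` {..<n} \<union> Serv ` {..<n}"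
  let ?l = "\<lambda>y. last_catastrophe nu t (\<lambda>i. y (Cat i)) m"
  let ?f = "\<lambda>y. (\<Prod>k<n. mark (?l y) (\<Sum>i<Suc k. y (Arr i)) (y (Serv k)), \<Sum>i<n. y (Arr i), ?l y)"
  have step: "expectation (\<lambda>\<omega>. ?F (?X \<omega>, ?Y \<omega>)) = expectation (\<lambda>\<omega>. expectation (\<lambda>\<omega>'. ?F (?X \<omega>, ?Y \<omega>')))"
  proof (rule expectation_disjoint_sources[where I = ?I and J = "{Arr n, Serv n}" and f = ?f
          and g = "\<lambda>y. (y (Arr n), y (Serv n))" and N = "borel \<Otimes>\<^sub>M borel \<Otimes>\<^sub>M borel"
          and N' = "borel \<Otimes>\<^sub>M borel" and c = 1])
    have [measurable]: "(\<lambda>y. y s) \<in> borel_measurable (PiM ?I (\<lambda>_. borel))" if "s \<in> ?I" for s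
      using that by (rule measurable_component_singleton)
    have [measurable]: "?l \<in> borel_measurable (PiM ?I (\<lambda>_. borel))" by measurable
    show "?f \<in> measurable (PiM ?I (\<lambda>_. borel)) (borel \<Otimes>\<^sub>M borel \<Otimes>\<^sub>M borel)"
      by (intro measurable_Pair borel_measurable_prod borel_measurable_mark borel_measurable_sum) auto
    show "?X \<omega> = ?f (\<lambda>s\<in>?I. source s \<omega>)" for \<omega>
      by (auto intro!: prod.cong sum.cong arg_cong2[where f = "mark _"] simp: image_iff)
    show "?F \<in> borel_measurable ((borel \<Otimes>\<^sub>M borel \<Otimes>\<^sub>M borel) \<Otimes>\<^sub>M borel \<Otimes>\<^sub>M borel)"
      by measurable
    show "cmod (?F (?X \<omega>, ?Y \<omega>')) \<le> 1" for \<omega> \<omega>'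
      unfolding prod.case fst_conv snd_conv norm_mult
      by (intro mult_le_one norm_marks_le norm_mark_le norm_Phi_le mult_nonneg_nonneg norm_ge_zero)
  qed auto
  have "expectation (\<lambda>\<omega>. marks (Suc n) (L m \<omega>) \<omega> * Phi (L m \<omega>) (\<Sum>i<Suc n. A i \<omega>)) =
      expectation (\<lambda>\<omega>. ?F (?X \<omega>, ?Y \<omega>))"
    by (simp add: mult.assoc)
  also have "\<dots> = expectation (\<lambda>\<omega>. expectation (\<lambda>\<omega>'. ?F (?X \<omega>, ?Y \<omega>')))"
    by (rule step)
  also have "\<dots> = expectation (\<lambda>\<omega>. marks n (L m \<omega>) \<omega> * Phi (L m \<omega>) (\<Sum>i<n. A i \<omega>))"
    by (simp add: expectation_mark_Phi)
  finally show ?case using Suc by simp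
qed simp

text \<open>Conditional mean of \<open>E (t - L)\<close> for the eventual \<open>L\<close>, when the latest epoch is \<open>s\<close> and the current value of \<open>L\<close> is \<open>l\<close>.\<close>

definition G :: "real \<Rightarrow> real \<Rightarrow> complex" where
  "G s l = K (t - s) + E (t - l) * of_real (exp (- nu * max 0 (t - s)))"

lemma borel_measurable_G[measurable (raw)]:
  assumes [measurable]: "f \<in> borel_measurable N" "g \<in> borel_measurable N"
  shows "(\<lambda>x. G (f x) (g x)) \<in> borel_measurable N"
  unfolding G_def by measurable

lemma norm_G_le: "cmod (G s l) \<le> 2"
proof -
  have "cmod (E (t - l) * of_real (exp (- nu * max 0 (t - s)))) \<le> 1"
    unfolding norm_mult by (intro mult_le_one norm_E_le) (auto simp: nu)
  then show ?thesis
    unfolding G_def using norm_K_le[of "t - s"] by (intro order_trans[OF norm_triangle_ineq]) auto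
qed

text \<open>If the next epoch occurs by \<open>t\<close>, it becomes the last catastrophe; otherwise
  \<open>l\<close> stays. As the integrand of \<open>K\<close> is continuous, no exceptional points
  arise.\<close>

lemma expectation_G:
  assumes "nu > 0"
  shows "expectation (\<lambda>\<omega>. G (s + D i \<omega>) (if s + D i \<omega> \<le> t then s + D i \<omega> else l)) = G s l"
proof -
  define b where "b = max 0 (t - s)"
  define f where "f y = G (s + y) (if s + y \<le> t then s + y else l)" for y
  define H where "H y = of_real (exp (- nu * y)) * K (t - s - y)" for y
  let ?f = "\<lambda>y. K (t - s - y) + E (t - s - y) * of_real (exp (- nu * (t - s - y)))"
  have "expectation (\<lambda>\<omega>. f (D i \<omega>)) = H 0 - H b + E (t - l) * of_real (exp (- nu * b))"
  proof (rule exponential_expectation_antiderivative[OF cat[OF assms] assms, where K = 2 and S = "{}"])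
    show "0 \<le> b" by (simp add: b_def)
    show "f \<in> borel_measurable borel" unfolding f_def[abs_def] by measurable
    show "cmod (f y) \<le> 2" for y unfolding f_def by (rule norm_G_le)
    have "isCont (\<lambda>y. K (t - s - y)) y" for y
      by (rule isCont_o2[OF _ isCont_K]) (intro continuous_intros)
    then show "continuous_on {0..b} H"
      unfolding H_def by (intro continuous_intros continuous_at_imp_continuous_on ballI)
    show "f y = E (t - l)" if "y > b" for y
      using that by (auto simp: f_def G_def b_def K_nonpos_arg)
    fix y assume y: "y \<in> {0<..<b} - {}"
    then have y_in: "y \<in> {..<t - s}" by (auto simp: b_def max_def split: if_splits)
    have f: "f u = ?f u" if "u \<in> {..<t - s}" for u
      using that by (auto simp: f_def G_def diff_diff_eq)
    have "\<forall>\<^sub>F u in nhds y. f u = ?f u"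
      using eventually_nhds_in_open[OF _ y_in] by (rule eventually_mono) (auto simp: f)
    moreover have "isCont ?f y"
      by (intro continuous_intros isCont_o2[OF _ isCont_E] isCont_o2[OF _ isCont_K])
    ultimately show "isCont f y" by (subst isCont_cong) auto
    have exp': "((\<lambda>y. complex_of_real (exp (- nu * y))) has_vector_derivative
        of_real (- nu * exp (- nu * y))) (at y)"
      by (rule bounded_linear.has_vector_derivative[OF bounded_linear_of_real])
        (auto simp flip: has_real_derivative_iff_has_vector_derivative intro!: derivative_eq_intros)
    have K': "((\<lambda>u. K (t - s - u)) has_vector_derivative
        (-1) *\<^sub>R (of_real (nu * exp (- nu * (t - s - y))) * E (t - s - y))) (at y)"
      using vector_diff_chain_at[of "\<lambda>u. t - s - u" "-1" y K] K_has_vector_derivative[of "t - s - y"] y_in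
      by (force simp: o_def intro!: derivative_eq_intros)
    show "(H has_vector_derivative - (of_real (nu * exp (- nu * y)) * f y)) (at y)"
      unfolding H_def
      by (rule has_vector_derivative_eq_rhs[OF has_vector_derivative_mult[OF exp' K']])
        (simp add: f[OF y_in] algebra_simps)
  qed simp
  moreover have "H b = 0" by (simp add: H_def b_def K_nonpos_arg)
  ultimately show ?thesis by (simp add: f_def H_def G_def b_def)
qed

text \<open>For \<open>nu = 0\<close>, \<open>L n\<close> stays 0 and \<open>K\<close> vanishes, so
  \<open>G\<close> is constant along the sequence; for \<open>nu > 0\<close> the next gap is
  averaged out by induction.\<close>

lemma expectation_catastrophes: "expectation (\<lambda>\<omega>. G (\<Sum>i<n. D i \<omega>) (L n \<omega>)) = G 0 0"
proof (cases "nu = 0")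
  case True
  have "L n \<omega> = 0" for \<omega> using True by (induction n) auto
  moreover have "K v = 0" for v unfolding K_def using True by simp
  ultimately show ?thesis unfolding G_def using True by (simp add: prob_space)
next
  case False
  then have "nu > 0" using nu by simp
  show ?thesis
  proof (induction n)
    case (Suc n)
    let ?F = "\<lambda>(u, d). G (fst u + d) (if fst u + d \<le> t then fst u + d else snd u)"
    let ?X = "\<lambda>\<omega>. (\<Sum>i<n. D i \<omega>, L n \<omega>)"
    let ?f = "\<lambda>y. (\<Sum>i<n. y (Cat i), last_catastrophe nu t (\<lambda>i. y (Cat i)) n)"
    have step: "expectation (\<lambda>\<omega>. ?F (?X \<omega>, D n \<omega>)) = expectation (\<lambda>\<omega>. expectation (\<lambda>\<omega>'. ?F (?X \<omega>, D n \<omega>')))"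
    proof (rule expectation_disjoint_sources[where I = "Cat ` {..<n}" and J = "{Cat n}"
          and f = ?f and g = "\<lambda>y. y (Cat n)" and N = "borel \<Otimes>\<^sub>M borel" and N' = borel and c = 2])
      show "?f \<in> measurable (PiM (Cat ` {..<n}) (\<lambda>_. borel)) (borel \<Otimes>\<^sub>M borel)"
        by (intro measurable_Pair borel_measurable_sum borel_measurable_last_catastrophe) auto
      show "?X \<omega> = ?f (\<lambda>s\<in>Cat ` {..<n}. source s \<omega>)" for \<omega>
        by (auto intro!: sum.cong last_catastrophe_cong)
      show "?F \<in> borel_measurable ((borel \<Otimes>\<^sub>M borel) \<Otimes>\<^sub>M borel)" by measurable
    qed (auto simp: norm_G_le)
    have "expectation (\<lambda>\<omega>. G (\<Sum>i<Suc n. D i \<omega>) (L (Suc n) \<omega>)) = expectation (\<lambda>\<omega>. ?F (?X \<omega>, D n \<omega>))"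
      using \<open>nu > 0\<close> by (simp add: if_distrib cong: if_cong)
    also have "\<dots> = expectation (\<lambda>\<omega>. expectation (\<lambda>\<omega>'. ?F (?X \<omega>, D n \<omega>')))"
      by (rule step)
    also have "\<dots> = expectation (\<lambda>\<omega>. G (\<Sum>i<n. D i \<omega>) (L n \<omega>))"
      by (simp only: prod.case fst_conv snd_conv expectation_G[OF \<open>nu > 0\<close>])
    finally show ?case using Suc by simp
  qed (simp add: prob_space)
qed

section \<open>The almost sure limit\<close>

lemma in_system_iff:
  "in_system A beta nu D t \<omega> k \<longleftrightarrow>
    (\<Sum>i<Suc k. A i \<omega>) \<le> t \<and> t < (\<Sum>i<Suc k. A i \<omega>) + beta k \<omega> \<and>
    (nu = 0 \<or> (\<forall>j. (\<Sum>i<Suc j. D i \<omega>) \<le> t \<longrightarrow> (\<Sum>i<Suc j. D i \<omega>) < (\<Sum>i<Suc k. A i \<omega>)))"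
  unfolding in_system_def arrival_time_def catastrophes_def lessThan_Suc_atMost
  by (auto simp: not_le)

lemma measurable_num_customers:
  "num_customers A beta nu D t \<in> measurable M (count_space UNIV)"
  unfolding num_customers_def[abs_def] in_system_iff by measurable

text \<open>Once \<open>n\<close> passes the index of a long gap of each kind, later epochs exceed
  \<open>t\<close>: \<open>Phi\<close> is 1, \<open>G\<close> cancels \<open>E (t - L n)\<close>,
  and the marks different from 1 by definition are those of the customers present.\<close>

lemma eventually_marks_eq:
  assumes A: "\<And>i. 0 < A i \<omega>" "t < A m \<omega>"
    and D: "nu > 0 \<Longrightarrow> (\<forall>i. 0 < D i \<omega>) \<and> (\<exists>i. t < D i \<omega>)"
  shows "\<forall>\<^sub>F n in sequentially. marks n (L n \<omega>) \<omega> * Phi (L n \<omega>) (\<Sum>i<n. A i \<omega>) +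
      G (\<Sum>i<n. D i \<omega>) (L n \<omega>) - E (t - L n \<omega>) = z ^ num_customers A beta nu D t \<omega>"
proof -
  have sum_gt: "t < (\<Sum>i<n. d i)" if "\<And>i. 0 < d i" "t < d k" "k < n" for d :: "nat \<Rightarrow> real" and k n
  proof -
    have "d k \<le> (\<Sum>i<n. d i)" using that by (intro member_le_sum) (auto intro: less_imp_le)
    then show ?thesis using that by simp
  qed
  \<comment> \<open>For \<open>nu = 0\<close> any index serves.\<close>
  obtain m' where m': "t < D m' \<omega>" if "nu > 0" using D by (cases "nu > 0") auto
  have "marks n (L n \<omega>) \<omega> * Phi (L n \<omega>) (\<Sum>i<n. A i \<omega>) +
      G (\<Sum>i<n. D i \<omega>) (L n \<omega>) - E (t - L n \<omega>) = z ^ num_customers A beta nu D t \<omega>"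
    if n: "n > m" "n > m'" for n
  proof -
    have T: "t < (\<Sum>i<k. A i \<omega>)" if "n \<le> k" for k
      using sum_gt[of "\<lambda>i. A i \<omega>" m k] A n that by auto
    have S: "t < (\<Sum>i<k. D i \<omega>)" if "n \<le> k" "nu > 0" for k
      using sum_gt[of "\<lambda>i. D i \<omega>" m' k] D m' n that by auto
    have "Phi (L n \<omega>) (\<Sum>i<n. A i \<omega>) = 1"
      using T[of n] by (simp add: Phi_def E_nonpos_arg)
    moreover have "G (\<Sum>i<n. D i \<omega>) (L n \<omega>) = E (t - L n \<omega>)"
    proof (cases "nu = 0")
      case True
      have "K v = 0" for v unfolding K_def using True by simp
      then show ?thesis unfolding G_def using True by simp
    next
      case False
      then show ?thesis using S[of n] nu by (simp add: G_def K_nonpos_arg)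
    qed
    moreover have "marks n (L n \<omega>) \<omega> = z ^ num_customers A beta nu D t \<omega>"
    proof -
      let ?T = "\<lambda>k. \<Sum>i<Suc k. A i \<omega>"
      let ?S = "\<lambda>j. \<Sum>i<Suc j. D i \<omega>"
      let ?N = "{k \<in> {..<n}. L n \<omega> < ?T k \<and> ?T k \<le> t \<and> t < ?T k + beta k \<omega>}"
      have "marks n (L n \<omega>) \<omega> = (\<Prod>k\<in>?N. z)"
        unfolding mark_def by (rule prod.inter_filter[symmetric]) simp
      also have "?N = {k. in_system A beta nu D t \<omega> k}"
      proof (intro Collect_cong)
        fix k
        have pos: "0 < ?T k" using A(1) by (intro sum_pos) auto
        have iff: "L n \<omega> < ?T k \<longleftrightarrow> nu = 0 \<or> (\<forall>j<n. ?S j \<le> t \<longrightarrow> ?S j < ?T k)"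
        proof (cases "nu = 0")
          case True
          then have "L n \<omega> = 0" by (induction n) auto
          then show ?thesis using True pos by simp
        next
          case False
          then show ?thesis using D nu pos by (intro less_last_catastrophe_iff) auto
        qed
        also have "\<dots> \<longleftrightarrow> nu = 0 \<or> (\<forall>j. ?S j \<le> t \<longrightarrow> ?S j < ?T k)"
          using S nu by (metis le_Suc_eq less_eq_real_def linorder_not_less not_le_imp_less)
        finally have L: "L n \<omega> < ?T k \<longleftrightarrow> nu = 0 \<or> (\<forall>j. ?S j \<le> t \<longrightarrow> ?S j < ?T k)" .
        have k: "k < n" if "?T k \<le> t"
          using T[of "Suc k"] that by (cases "k < n") auto
        show "k \<in> {..<n} \<and> L n \<omega> < ?T k \<and> ?T k \<le> t \<and> t < ?T k + beta k \<omega> \<longleftrightarrow>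
            in_system A beta nu D t \<omega> k"
          unfolding in_system_iff L using k by blast
      qed
      finally show ?thesis by (simp add: num_customers_def)
    qed
    ultimately show ?thesis by simp
  qed
  then show ?thesis
    by (intro eventually_mono[OF eventually_gt_at_top[of "max m m'"]]) auto
qed

text \<open>Each \<open>?Z n\<close> has mean \<open>G 0 0\<close>: the arrival martingale has the
  mean of \<open>E (t - L n)\<close>, which is subtracted, and the catastrophe martingale supplies
  the rest.\<close>

lemma expectation_generating_function:
  "expectation (\<lambda>\<omega>. z ^ num_customers A beta nu D t \<omega>) = G 0 0"
proof -
  let ?Z = "\<lambda>n \<omega>. marks n (L n \<omega>) \<omega> * Phi (L n \<omega>) (\<Sum>i<n. A i \<omega>) +
      G (\<Sum>i<n. D i \<omega>) (L n \<omega>) - E (t - L n \<omega>)"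
  have int_marks: "integrable M (\<lambda>\<omega>. marks n (L n \<omega>) \<omega> * Phi (L n \<omega>) (\<Sum>i<n. A i \<omega>))" for n
    by (rule integrable_const_bound[of _ 1])
      (auto simp: norm_mult simp del: sum.lessThan_Suc intro!: mult_le_one norm_marks_le norm_Phi_le)
  have int_G: "integrable M (\<lambda>\<omega>. G (\<Sum>i<n. D i \<omega>) (L n \<omega>))" for n
    by (rule integrable_const_bound[of _ 2]) (auto simp: norm_G_le)
  have int_E: "integrable M (\<lambda>\<omega>. E (t - L n \<omega>))" for n
    by (rule integrable_const_bound[of _ 1]) (auto simp: norm_E_le)
  have D_pos: "AE \<omega> in M. nu > 0 \<longrightarrow> (\<forall>i. 0 < D i \<omega>) \<and> (\<exists>i. t < D i \<omega>)"
  proof (cases "nu > 0")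
    case True
    have "infinite (range Cat)" by (intro range_inj_infinite) (auto simp: inj_def)
    then have "AE \<omega> in M. \<exists>s\<in>range Cat. t < source s \<omega>"
      by (intro AE_ex_exponential_gt[OF indep_vars_subset[OF indep], where l = nu]) (use cat[OF True] True t in auto)
    then have "AE \<omega> in M. \<exists>i. t < D i \<omega>" by simp
    moreover have "AE \<omega> in M. \<forall>i. 0 < D i \<omega>"
      unfolding AE_all_countable using AE_exponential_pos[OF cat[OF True] True] by blast
    ultimately show ?thesis by eventually_elim simp
  qed simp
  have A_pos: "AE \<omega> in M. (\<forall>i. 0 < A i \<omega>) \<and> (\<exists>i. t < A i \<omega>)"
  proof -
    have "infinite (range Arr)" by (intro range_inj_infinite) (auto simp: inj_def)
    then have "AE \<omega> in M. \<exists>s\<in>range Arr. t < source s \<omega>"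
      by (intro AE_ex_exponential_gt[OF indep_vars_subset[OF indep], where l = lam]) (use arr lam t in auto)
    then have "AE \<omega> in M. \<exists>i. t < A i \<omega>" by simp
    moreover have "AE \<omega> in M. \<forall>i. 0 < A i \<omega>"
      unfolding AE_all_countable using AE_exponential_pos[OF arr lam] by blast
    ultimately show ?thesis by eventually_elim simp
  qed
  have "expectation (?Z n) = G 0 0" for n
  proof -
    have L0: "L n \<omega> \<ge> 0" if "nu > 0 \<longrightarrow> (\<forall>i. 0 < D i \<omega>)" for \<omega>
      using that nu by (induction n) (auto simp del: sum.lessThan_Suc intro!: sum_nonneg intro: less_imp_le)
    \<comment> \<open>The equality is only almost sure: a null set may carry negative gaps and hence
      a negative \<open>L n\<close>.\<close>
    have "expectation (\<lambda>\<omega>. Phi (L n \<omega>) 0) = expectation (\<lambda>\<omega>. E (t - L n \<omega>))"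
    proof (rule integral_cong_AE)
      show "AE \<omega> in M. Phi (L n \<omega>) 0 = E (t - L n \<omega>)"
        using D_pos by eventually_elim (use L0 in \<open>auto simp: Phi_def max_def\<close>)
    qed auto
    then show ?thesis
      using int_marks int_G int_E by (simp del: sum.lessThan_Suc add: expectation_arrivals expectation_catastrophes)
  qed
  moreover have "(\<lambda>n. expectation (?Z n)) \<longlonglongrightarrow> expectation (\<lambda>\<omega>. z ^ num_customers A beta nu D t \<omega>)"
  proof (rule integral_dominated_convergence[where w = "\<lambda>_. 4"])
    show "(\<lambda>\<omega>. z ^ num_customers A beta nu D t \<omega>) \<in> borel_measurable M"
      by (rule measurable_compose[OF measurable_num_customers]) simp
    show "?Z n \<in> borel_measurable M" for n by measurable
    show "AE \<omega> in M. (\<lambda>n. ?Z n \<omega>) \<longlonglongrightarrow> z ^ num_customers A beta nu D t \<omega>"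
      using A_pos D_pos
      by eventually_elim (use eventually_marks_eq in \<open>blast intro: tendsto_eventually\<close>)
    have "cmod (?Z n \<omega>) \<le> 1 + 2 + 1" for n \<omega>
    proof (intro order_trans[OF norm_triangle_ineq4] order_trans[OF norm_triangle_ineq] add_mono)
      show "cmod (marks n (L n \<omega>) \<omega> * Phi (L n \<omega>) (\<Sum>i<n. A i \<omega>)) \<le> 1"
        unfolding norm_mult by (intro mult_le_one norm_marks_le norm_Phi_le norm_ge_zero)
    qed (rule norm_G_le norm_E_le)+
    then show "AE \<omega> in M. cmod (?Z n \<omega>) \<le> 4" for n by simp
  qed simp
  ultimately show ?thesis by (simp add: LIMSEQ_const_iff)
qed

end

theorem theorem2:
  fixes M :: "'a measure"
    and A beta D :: "nat \<Rightarrow> 'a \<Rightarrow> real"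
    and B :: "real \<Rightarrow> real"
    and lam nu t :: real
    and z :: complex
  assumes "prob_space M"
    and "lam > 0" and "nu \<ge> 0"
    and indep: "prob_space.indep_vars M (\<lambda>_. borel)
          (\<lambda>s. case s of Arr i \<Rightarrow> A i | Serv i \<Rightarrow> beta i | Cat i \<Rightarrow> D i) UNIV"
    and arr: "\<And>i. distributed M lborel (A i) (exponential_density lam)"
    and cat: "nu > 0 \<Longrightarrow> (\<And>i. distributed M lborel (D i) (exponential_density nu))"
    and serv_cdf: "\<And>i x. measure M {\<omega> \<in> space M. beta i \<omega> \<le> x} = B x"
    and B_nonneg: "\<And>x. x < 0 \<Longrightarrow> B x = 0"
    and mean: "\<And>i. integrable M (beta i)"
    and "t \<ge> 0" and "cmod z \<le> 1"
  shows "(\<integral>\<omega>. z ^ num_customers A beta nu D t \<omega> \<partial>M) =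
    exp (- complex_of_real (nu * t) - complex_of_real lam * (1 - z) * complex_of_real (integral {0..t} (\<lambda>x. 1 - B x)))
    + complex_of_real nu * integral {0..t} (\<lambda>u. exp (- complex_of_real (nu * u)
          - complex_of_real lam * (1 - z) * complex_of_real (integral {0..u} (\<lambda>x. 1 - B x))))"
proof -
  interpret prob_space M by fact
  interpret catastrophe_queue M A beta D B lam nu t z
    by unfold_locales (use assms in auto)
  \<comment> \<open>Splitting the exponent brings both the boundary term and the integrand into the
    form used in \<open>G\<close> and \<open>K\<close>.\<close>
  have exp_E: "exp (- complex_of_real (nu * u) - complex_of_real lam * (1 - z) * complex_of_real (C u)) =
      of_real (exp (- nu * u)) * E u" for u
  proof -
    have "- complex_of_real (nu * u) - complex_of_real lam * (1 - z) * complex_of_real (C u) =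
        of_real (- nu * u) + (- of_real lam * (1 - z) * of_real (C u))" by simp
    then show ?thesis unfolding E_def by (simp only: exp_add exp_of_real)
  qed
  have "K t = of_real nu * integral {0..t} (\<lambda>u. of_real (exp (- nu * u)) * E u)"
    unfolding K_def by (simp add: mult.assoc flip: integral_mult_right)
  then show ?thesis
    using \<open>t \<ge> 0\<close> unfolding expectation_generating_function C_def[symmetric] exp_E
    by (simp add: G_def)
qed

end
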